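(* Let $\mathcal{A}$ be a compact Hausdorff abelian group and let $\varrho$ be a substitution of constant length $L$ on $\mathcal{A}$ such that each column $\theta\mapsto\varrho(\theta)_j$, $0\le j\le L-1$, is either a group translation or constant, with at least one constant column. Let $w\in X_\varrho$ be a pseudo-fixed point of $\varrho$. Then, for every character $\chi\in\widehat{\mathcal{A}}$, the weighted Dirac comb $\omega_\chi=\sum_{m\in\mathbb{Z}}\chi(w_m)\delta_m$ has pure point diffraction.
   Context: Substitutions. An alphabet $\mathcal{A}$ is a compact Hausdorff space; $\mathcal{A}^+=\bigsqcup_{n\ge1}\mathcal{A}^n$ is the space of finite non-empty words. A substitution is a continuous map $\varrho\colon\mathcal{A}\to\mathcal{A}^+$, extended to words and bi-infinite sequences by concatenation (in $\varrho(w)$ the word $\varrho(w_0)$ begins at position $0$); it is always assumed that $|\varrho(a)|\ge 2$ for some $a$. It has constant length $L$ if $\varrho(\mathcal{A})\subset\mathcal{A}^L$ (so $L\ge2$); its columns are the maps $\varrho_j(a)=(\varrho(a))_j$, $0\le j\le L-1$. A column is a group translation if $\varrho_j(a)=\beta_j a$ for some $\beta_j\in\mathcal{A}$, and constant if $\varrho_j(a)=\beta_j$ for all $a$. $\mathcal{L}^n(\varrho)$ is the closure in $\mathcal{A}^n$ of the set of length-$n$ words that occur as subwords of some $\varrho^k(a)$, $a\in\mathcal{A}$, $k\ge1$. The subshift is $X_\varrho=\{w\in\mathcal{A}^{\mathbb{Z}} : w_{[i,j]}\in\mathcal{L}^{j-i+1}(\varrho)\text{ for all } i\le j\}$, with left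 shift $\sigma(w)_n=w_{n+1}$. A pseudo-fixed point of a constant-length-$L$ substitution $\varrho$ is $w\in X_\varrho$ with $\varrho(w)=\sigma^s(w)$ for some $0\le s\le L-1$. Diffraction. $\widehat{\mathcal{A}}$ is the set of continuous homomorphisms $\chi\colon\mathcal{A}\to S^1\subset\mathbb{C}$. The autocorrelation coefficients of $\omega_\chi$ are $\eta(m)=\lim_{N\to\infty}\frac{1}{2N+1}\sum_{j=-N}^{N}\chi(w_j)\overline{\chi(w_{j+m})}$ (these limits exist in this setting), the autocorrelation is $\gamma=\sum_{m\in\mathbb{Z}}\eta(m)\delta_m$, and the diffraction measure $\widehat{\gamma}$ is its Fourier transform, a positive $\mathbb{Z}$-periodic measure on $\mathbb{R}$: it is the $\mathbb{Z}$-periodisation of the positive measure on $\mathbb{T}=\mathbb{R}/\mathbb{Z}$ whose Fourier coefficients are $\eta(m)$. The diffraction is pure point if $\widehat\gamma$ is a pure point measure. *)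

theory Defs
  imports "HOL-Analysis.Analysis" "HOL-Library.Sublist"
begin

section \<open>Substitutions on compact alphabets\<close>

text \<open>
  Finite non-empty words over \<open>'a\<close> are non-empty lists.  They carry the disjoint union topology of
  the product spaces \<open>'a\<^sup>n\<close>, \<open>n \<ge> 1\<close>, transported along \<open>word_code\<close>.
\<close>

definition word_code :: "'a list \<Rightarrow> nat \<times> (nat \<Rightarrow> 'a)" where
  "word_code u = (length u, restrict (\<lambda>i. u ! i) {..<length u})"

definition word_topology :: "'a::topological_space list topology" where
  "word_topology = pullback_topology {u. u \<noteq> []} word_code
     (sum_topology (\<lambda>n. product_topology (\<lambda>_. euclidean) {..<n}) {1..})"

lemma topspace_word_topology: "topspace word_topology = {u. u \<noteq> []}"
proof -
  have "word_code u \<in> Sigma {1..} (\<lambda>n. PiE {..<n} (\<lambda>_. UNIV))" if "u \<noteq> []" for u :: "'a list"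
    using that by (cases u) (auto simp: word_code_def)
  then show ?thesis
    by (auto simp: word_topology_def topspace_pullback_topology o_def)
qed

definition substitution :: "('a::topological_space \<Rightarrow> 'a list) \<Rightarrow> bool" where
  "substitution \<rho> \<longleftrightarrow>
     continuous_map euclidean word_topology \<rho> \<and> (\<exists>a. 2 \<le> length (\<rho> a))"

definition constant_length :: "('a \<Rightarrow> 'a list) \<Rightarrow> nat \<Rightarrow> bool" where
  "constant_length \<rho> L \<longleftrightarrow> (\<forall>a. length (\<rho> a) = L)"

definition subst_column :: "('a \<Rightarrow> 'a list) \<Rightarrow> nat \<Rightarrow> 'a \<Rightarrow> 'a" where
  "subst_column \<rho> j a = \<rho> a ! j"

text \<open>The abelian group structure on the alphabet is written additively.\<close>

definition group_translation :: "('a::ab_group_add \<Rightarrow> 'a) \<Rightarrow> bool" where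
  "group_translation f \<longleftrightarrow> (\<exists>\<beta>. \<forall>a. f a = \<beta> + a)"

definition constant_map :: "('a \<Rightarrow> 'b) \<Rightarrow> bool" where
  "constant_map f \<longleftrightarrow> (\<exists>\<beta>. \<forall>a. f a = \<beta>)"

definition subst_word :: "('a \<Rightarrow> 'a list) \<Rightarrow> 'a list \<Rightarrow> 'a list" where
  "subst_word \<rho> u = concat (map \<rho> u)"

text \<open>\<open>subst_pos \<rho> w n\<close> is the position in \<open>\<rho>(w)\<close> at which the block \<open>\<rho>(w\<^sub>n)\<close> begins.\<close>

definition subst_pos :: "('a \<Rightarrow> 'a list) \<Rightarrow> (int \<Rightarrow> 'a) \<Rightarrow> int \<Rightarrow> int" where
  "subst_pos \<rho> w n =
     (if 0 \<le> n then \<Sum>i\<in>{0..<n}. int (length (\<rho> (w i)))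
      else - (\<Sum>i\<in>{n..<0}. int (length (\<rho> (w i)))))"

definition subst_biseq :: "('a \<Rightarrow> 'a list) \<Rightarrow> (int \<Rightarrow> 'a) \<Rightarrow> int \<Rightarrow> 'a" where
  "subst_biseq \<rho> w =
     (THE v. \<forall>n. \<forall>i<length (\<rho> (w n)). v (subst_pos \<rho> w n + int i) = \<rho> (w n) ! i)"

lemma subst_biseq_constant_length:
  assumes "constant_length \<rho> L" and "0 < L"
  shows "subst_biseq \<rho> w m = \<rho> (w (m div int L)) ! nat (m mod int L)"
proof -
  have len: "length (\<rho> a) = L" for a
    using assms by (simp add: constant_length_def)
  have pos: "subst_pos \<rho> w n = int L * n" for n
    by (simp add: subst_pos_def len)
  have "subst_biseq \<rho> w = (\<lambda>m. \<rho> (w (m div int L)) ! nat (m mod int L))"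
    unfolding subst_biseq_def
  proof (rule the_equality)
    show "\<forall>n. \<forall>i<length (\<rho> (w n)).
        \<rho> (w ((subst_pos \<rho> w n + int i) div int L)) ! nat ((subst_pos \<rho> w n + int i) mod int L)
          = \<rho> (w n) ! i"
      by (auto simp: len pos)
  next
    fix v assume v: "\<forall>n. \<forall>i<length (\<rho> (w n)). v (subst_pos \<rho> w n + int i) = \<rho> (w n) ! i"
    show "v = (\<lambda>m. \<rho> (w (m div int L)) ! nat (m mod int L))"
    proof
      fix m :: int
      have "0 \<le> m mod int L" "m mod int L < int L"
        using assms(2) by simp_all
      then have "nat (m mod int L) < L" by linarith
      with v have "v (int L * (m div int L) + int (nat (m mod int L)))
          = \<rho> (w (m div int L)) ! nat (m mod int L)"
        by (metis len pos)
      then show "v m = \<rho> (w (m div int L)) ! nat (m mod int L)"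
        using \<open>0 \<le> m mod int L\<close> by simp
    qed
  qed
  then show ?thesis by simp
qed

definition language :: "('a::topological_space \<Rightarrow> 'a list) \<Rightarrow> nat \<Rightarrow> 'a list set" where
  "language \<rho> n =
     subtopology word_topology {u. length u = n} closure_of
       {u. length u = n \<and> (\<exists>k\<ge>1. \<exists>a. sublist u ((subst_word \<rho> ^^ k) [a]))}"

definition subshift :: "('a::topological_space \<Rightarrow> 'a list) \<Rightarrow> (int \<Rightarrow> 'a) set" where
  "subshift \<rho> = {w. \<forall>i j. i \<le> j \<longrightarrow> map w [i..j] \<in> language \<rho> (nat (j - i + 1))}"

definition shift :: "(int \<Rightarrow> 'a) \<Rightarrow> int \<Rightarrow> 'a" where
  "shift w n = w (n + 1)"

definition pseudo_fixed_point :: "('a::topological_space \<Rightarrow> 'a list) \<Rightarrow> nat \<Rightarrow> (int \<Rightarrow> 'a) \<Rightarrow> bool" where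
  "pseudo_fixed_point \<rho> L w \<longleftrightarrow>
     w \<in> subshift \<rho> \<and> (\<exists>s. s < L \<and> subst_biseq \<rho> w = (shift ^^ s) w)"

definition character :: "('a::{topological_space, ab_group_add} \<Rightarrow> complex) \<Rightarrow> bool" where
  "character chi \<longleftrightarrow>
     continuous_on UNIV chi \<and> (\<forall>a. cmod (chi a) = 1) \<and> (\<forall>a b. chi (a + b) = chi a * chi b)"


section \<open>Diffraction of weighted Dirac combs\<close>

text \<open>
  A weighted Dirac comb \<open>\<Sum>m. f(m) \<delta>\<^sub>m\<close> supported on the integers is represented by its weight
  function \<open>f\<close>, and its autocorrelation \<open>\<Sum>m. \<eta>(m) \<delta>\<^sub>m\<close> by the coefficients \<open>\<eta>\<close>.
\<close>

definition autocorr_avg :: "(int \<Rightarrow> complex) \<Rightarrow> int \<Rightarrow> nat \<Rightarrow> complex" where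
  "autocorr_avg f m N = (\<Sum>j\<in>{- int N..int N}. f j * cnj (f (j + m))) / of_nat (2 * N + 1)"

definition autocorr :: "(int \<Rightarrow> complex) \<Rightarrow> int \<Rightarrow> complex" where
  "autocorr f m = lim (autocorr_avg f m)"

text \<open>
  Finite positive measures on \<open>\<real>/\<int>\<close> are finite Borel measures on the fundamental domain \<open>[0,1)\<close>.
\<close>

definition torus_measure :: "real measure \<Rightarrow> bool" where
  "torus_measure \<nu> \<longleftrightarrow> finite_measure \<nu> \<and> sets \<nu> = sets (restrict_space borel {0..<1})"

definition fourier_coeff :: "real measure \<Rightarrow> int \<Rightarrow> complex" where
  "fourier_coeff \<nu> m = (LINT t|\<nu>. cis (- 2 * pi * of_int m * t))"

definition periodisation :: "real measure \<Rightarrow> real measure" where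
  "periodisation \<nu> =
     distr (count_space (UNIV :: int set) \<Otimes>\<^sub>M \<nu>) borel (\<lambda>(n, t). of_int n + t)"

lemma emeasure_periodisation:
  assumes "torus_measure \<nu>" and "B \<in> sets borel"
  shows "emeasure (periodisation \<nu>) B =
    (\<integral>\<^sup>+ n. emeasure \<nu> {t \<in> {0..<1}. of_int n + t \<in> B} \<partial>count_space (UNIV :: int set))"
proof -
  interpret finite_measure \<nu> using assms(1) by (simp add: torus_measure_def)
  have sets: "sets \<nu> = sets (restrict_space borel {0..<1})"
    using assms(1) by (simp add: torus_measure_def)
  have space: "space \<nu> = {0..<1}"
    using sets_eq_imp_space_eq[OF sets] by (simp add: space_restrict_space)
  have id: "(\<lambda>t. t) \<in> measurable \<nu> borel"
    unfolding measurable_cong_sets[OF sets refl] by (rule measurable_restrict_space1) simp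
  have meas: "(\<lambda>(n, t). of_int n + t) \<in> measurable (count_space (UNIV :: int set) \<Otimes>\<^sub>M \<nu>) borel"
    by (rule measurable_pair_measure_countable1) (use id in auto)
  let ?P = "(\<lambda>(n, t). of_int n + t) -` B \<inter> space (count_space (UNIV :: int set) \<Otimes>\<^sub>M \<nu>)"
  have "emeasure (periodisation \<nu>) B = emeasure (count_space UNIV \<Otimes>\<^sub>M \<nu>) ?P"
    unfolding periodisation_def using meas assms(2) by (simp add: emeasure_distr)
  also have "\<dots> = (\<integral>\<^sup>+ n. emeasure \<nu> (Pair n -` ?P) \<partial>count_space UNIV)"
    by (rule emeasure_pair_measure_alt) (rule measurable_sets[OF meas assms(2)])
  also have "\<dots> = (\<integral>\<^sup>+ n. emeasure \<nu> {t \<in> {0..<1}. of_int n + t \<in> B} \<partial>count_space UNIV)"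
    by (intro nn_integral_cong arg_cong2[where f = emeasure])
       (auto simp: space_pair_measure space)
  finally show ?thesis .
qed

definition is_diffraction_measure :: "(int \<Rightarrow> complex) \<Rightarrow> real measure \<Rightarrow> bool" where
  "is_diffraction_measure f M \<longleftrightarrow>
     (\<forall>m. convergent (autocorr_avg f m)) \<and>
     (\<exists>\<nu>. torus_measure \<nu> \<and> (\<forall>m. fourier_coeff \<nu> m = autocorr f m) \<and> M = periodisation \<nu>)"

definition pure_point_measure :: "real measure \<Rightarrow> bool" where
  "pure_point_measure M \<longleftrightarrow>
     (\<forall>B\<in>sets M. emeasure M B = (\<integral>\<^sup>+ x. emeasure M {x} \<partial>count_space B))"

text \<open>
  A finite measure on \<open>\<real>/\<int>\<close> is determined by its Fourier coefficients, so there is at most one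
  diffraction measure; the definition asks that it exists and is pure point.
\<close>

definition pure_point_diffraction :: "(int \<Rightarrow> complex) \<Rightarrow> bool" where
  "pure_point_diffraction f \<longleftrightarrow>
     (\<exists>M. is_diffraction_measure f M) \<and>
     (\<forall>M. is_diffraction_measure f M \<longrightarrow> pure_point_measure M)"

end

theory Submission
  imports Defs "HOL-Probability.Levy"
begin

text \<open>
  Write \<open>f(m) = \<chi>(w\<^sub>m)\<close>.  The relation \<open>\<rho>(w) = \<sigma>\<^sup>s(w)\<close> expresses \<open>f(Lm + j + s)\<close> through \<open>f(m)\<close> and \<open>j\<close>,
  and forgets \<open>f(m)\<close> when column \<open>j\<close> is constant.  Iterating, the residues \<open>p\<close> modulo \<open>L\<^sup>n\<close> for which
  \<open>f\<close> is not constant on \<open>p + L\<^sup>n\<int>\<close> have proportion at most \<open>((L - 1)/L)\<^sup>n\<close>.  Hence \<open>f\<close> is a limit in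
  mean of periodic sequences, the autocorrelation \<open>\<eta>\<close> exists, and \<open>\<eta>\<close> is within \<open>2((L - 1)/L)\<^sup>n\<close>
  of \<open>\<eta>(0)\<close> on all multiples of \<open>q = L\<^sup>n\<close>.  A measure \<open>\<nu>\<close> with coefficients \<open>\<eta>\<close> is a weak limit of the
  densities \<open>|\<Sum>\<^sub>j f(j) e(-jt)|\<^sup>2/(2N + 1)\<close>.  Averaging the coefficients of any such \<open>\<nu>\<close> over the multiples
  of \<open>q\<close> gives \<open>\<nu>({t. q t \<in> \<int>})\<close>, which is therefore close to the total mass \<open>\<eta>(0)\<close>; so \<open>\<nu>\<close> lives on the
  rationals.
\<close>

section \<open>Means of nearly periodic sequences\<close>

text \<open>Polymorphic in the field, so that complex autocorrelations and real densities are
  averaged by the same lemmas.\<close>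

definition sym_mean :: "(int \<Rightarrow> 'b::real_normed_field) \<Rightarrow> nat \<Rightarrow> 'b" where
  "sym_mean f N = (\<Sum>j\<in>{- int N..int N}. f j) / of_nat (2 * N + 1)"

lemma autocorr_avg_sym_mean: "autocorr_avg f m = sym_mean (\<lambda>j. f j * cnj (f (j + m)))"
  by (auto simp: autocorr_avg_def sym_mean_def)

lemma telescope_int: "(\<Sum>j\<in>{- int N..int N}. g (j + 1) - g j) = g (int N + 1) - (g (- int N) :: 'b::ab_group_add)"
proof (induction N)
  case (Suc N)
  have "{- int (Suc N)..int (Suc N)} = insert (- int (Suc N)) (insert (int (Suc N)) {- int N..int N})"
    by auto
  then have "(\<Sum>j\<in>{- int (Suc N)..int (Suc N)}. g (j + 1) - g j)
    = (g (- int (Suc N) + 1) - g (- int (Suc N))) + ((g (int (Suc N) + 1) - g (int (Suc N)))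
      + (\<Sum>j\<in>{- int N..int N}. g (j + 1) - g j))"
    by (simp del: of_nat_Suc)
  then show ?case unfolding Suc by (simp add: algebra_simps)
qed simp

lemma sym_mean_diff: "sym_mean f N - sym_mean g N = sym_mean (\<lambda>j. f j - g j) N"
  by (simp add: sym_mean_def sum_subtractf diff_divide_distrib)

lemma const_div_odd_tendsto_0: "(\<lambda>N. C / real (2 * N + 1)) \<longlonglongrightarrow> 0"
proof -
  have "filterlim (\<lambda>N. real (2 * N + 1)) at_top sequentially"
    by (rule filterlim_compose[OF filterlim_real_sequentially])
      (auto intro!: filterlim_subseq simp: strict_mono_def)
  then show ?thesis
    by (rule real_tendsto_divide_at_top[OF tendsto_const])
qed

text \<open>Moving the window by one step changes the sum by two boundary terms only, at most
  \<open>2 * C\<close> against the length \<open>2 * N + 1\<close>; a shift by \<open>r\<close> is a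
  chain of such steps.\<close>

lemma sym_mean_shift:
  fixes f :: "int \<Rightarrow> 'b::real_normed_field"
  assumes "\<And>j. norm (f j) \<le> C"
  shows "(\<lambda>N. sym_mean (\<lambda>j. f (j + int r)) N - sym_mean f N) \<longlonglongrightarrow> 0"
proof (induction r)
  case (Suc r)
  have "(\<lambda>N. sym_mean (\<lambda>j. f (j + int (Suc r))) N - sym_mean (\<lambda>j. f (j + int r)) N) \<longlonglongrightarrow> 0"
  proof (rule Lim_null_comparison[OF _ const_div_odd_tendsto_0[of "2 * C"]], intro always_eventually allI)
    fix N
    have "sym_mean (\<lambda>j. f (j + int (Suc r))) N - sym_mean (\<lambda>j. f (j + int r)) N
        = (f (int N + 1 + int r) - f (- int N + int r)) / of_nat (2 * N + 1)"
      using telescope_int[of "\<lambda>j. f (j + int r)" N]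
      by (simp add: sym_mean_diff) (simp add: sym_mean_def algebra_simps)
    moreover have "norm (f (int N + 1 + int r) - f (- int N + int r)) \<le> 2 * C"
      using norm_triangle_ineq4 assms by (smt (verit))
    ultimately show "norm (sym_mean (\<lambda>j. f (j + int (Suc r))) N - sym_mean (\<lambda>j. f (j + int r)) N)
        \<le> 2 * C / real (2 * N + 1)"
      by (simp only: norm_divide norm_of_nat) (intro divide_right_mono, auto)
  qed
  from tendsto_add[OF this Suc] show ?case by simp
qed simp

text \<open>Sliding the window by one step replaces \<open>P j\<close> by
  \<open>P (j + int q)\<close>, which has the same value; the integer induction goes both ways from
  \<open>0\<close>.\<close>

lemma periodic_window_sum:
  fixes P :: "int \<Rightarrow> 'b::ab_group_add"
  assumes "\<And>j. P (j + int q) = P j"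
  shows "(\<Sum>r<q. P (j + int r)) = (\<Sum>r<q. P (int r))"
proof -
  have step: "(\<Sum>r<q. P (j + 1 + int r)) = (\<Sum>r<q. P (j + int r))" for j
  proof -
    have "(\<Sum>r<q. P (j + 1 + int r)) + P j = (\<Sum>r<Suc q. P (j + int r))"
      by (simp add: sum.lessThan_Suc_shift algebra_simps del: sum.lessThan_Suc)
    then show ?thesis using assms by simp
  qed
  show ?thesis
  proof (induction j rule: int_induct[where k = 0])
    case (step2 i)
    then show ?case using step[of "i - 1"] by simp
  qed (use step in \<open>simp_all\<close>)
qed

lemma periodic_mult:
  assumes "\<And>j. P (j + int q) = P j"
  shows "P (j + int q * k) = P j"
proof (induction k rule: int_induct[where k = 0])
  case (step1 i)
  then show ?case using assms[of "j + int q * i"] by (simp add: algebra_simps)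
next
  case (step2 i)
  then show ?case using assms[of "j + int q * (i - 1)"] by (simp add: algebra_simps)
qed simp

text \<open>Averaging over the \<open>q\<close> shifts of \<open>P\<close> makes the mean exact,
  since all windows of length \<open>q\<close> have the same sum, and each shifted mean differs from
  the original one by a null sequence.\<close>

lemma sym_mean_periodic:
  fixes P :: "int \<Rightarrow> 'b::real_normed_field"
  assumes per: "\<And>j. P (j + int q) = P j" and "q > 0"
  shows "sym_mean P \<longlonglongrightarrow> (\<Sum>r<q. P (int r)) / of_nat q"
proof -
  define C where "C = (\<Sum>r<q. norm (P (int r)))"
  have bound: "norm (P j) \<le> C" for j
  proof -
    have "P j = P (j mod int q)"
      using periodic_mult[of P q "j mod int q" "j div int q", OF per] by simp
    moreover have "nat (j mod int q) < q" "int (nat (j mod int q)) = j mod int q"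
      using \<open>q > 0\<close> by (simp_all add: nat_less_iff)
    ultimately show ?thesis
      unfolding C_def using member_le_sum[of "nat (j mod int q)" "{..<q}" "\<lambda>r. norm (P (int r))"] by simp
  qed
  \<comment> \<open>\<open>?D\<close> averages the errors of the \<open>q\<close> shifts;
    subtracting it from the mean over one period gives \<open>sym_mean P N\<close> exactly.\<close>
  let ?D = "\<lambda>N. (\<Sum>r<q. sym_mean (\<lambda>j. P (j + int r)) N - sym_mean P N) / of_nat q"
  have "(\<lambda>N. (\<Sum>r<q. P (int r)) / of_nat q - ?D N) \<longlonglongrightarrow> (\<Sum>r<q. P (int r)) / of_nat q - (\<Sum>r<q. 0) / of_nat q"
    by (intro tendsto_diff tendsto_const tendsto_divide tendsto_sum sym_mean_shift[OF bound])
      (use \<open>q > 0\<close> in auto)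
  moreover have "(\<Sum>r<q. P (int r)) / of_nat q - ?D N = sym_mean P N" for N
  proof -
    have card: "card {- int N..int N} = 2 * N + 1" by simp
    have "(\<Sum>r<q. sym_mean (\<lambda>j. P (j + int r)) N)
        = (\<Sum>j\<in>{- int N..int N}. \<Sum>r<q. P (j + int r)) / of_nat (2 * N + 1)"
      unfolding sym_mean_def sum_divide_distrib[symmetric] by (subst sum.swap) simp
    also have "\<dots> = (\<Sum>r<q. P (int r))"
      unfolding periodic_window_sum[of P q, OF per]
      unfolding sum_constant card by (rule nonzero_mult_div_cancel_left, subst of_nat_eq_0_iff) simp
    finally show ?thesis
      using \<open>q > 0\<close> by (simp add: sum_subtractf diff_divide_distrib)
  qed
  ultimately show ?thesis by simp
qed

section \<open>Residue classes on which a sequence is not constant, and their density\<close>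

definition exceptional :: "(int \<Rightarrow> 'b) \<Rightarrow> nat \<Rightarrow> int set" where
  "exceptional f q = {p. \<exists>k. f (p + int q * k) \<noteq> f p}"

definition exceptional_count :: "(int \<Rightarrow> 'b) \<Rightarrow> nat \<Rightarrow> real" where
  "exceptional_count f q = (\<Sum>r<q. of_bool (int r \<in> exceptional f q))"

text \<open>The density condition of regular Toeplitz sequences: off a union of residue classes of
  density at most \<epsilon>, \<open>f\<close> coincides with a \<open>q\<close>-periodic
  sequence.\<close>

definition nearly_periodic :: "(int \<Rightarrow> 'b) \<Rightarrow> bool" where
  "nearly_periodic f \<longleftrightarrow> (\<forall>\<epsilon>>0. \<exists>q>0. exceptional_count f q \<le> \<epsilon> * real q)"

lemma exceptional_periodic: "p + int q \<in> exceptional f q \<longleftrightarrow> p \<in> exceptional f q"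
proof -
  have *: "p \<notin> exceptional f q \<longleftrightarrow> (\<forall>k. f (p + int q * k) = f p)" for p
    by (simp add: exceptional_def)
  have shift: "p + int q + int q * k = p + int q * (k + 1)" for k by (simp add: algebra_simps)
  have "p + int q \<notin> exceptional f q \<longleftrightarrow> p \<notin> exceptional f q"
  proof
    assume "p + int q \<notin> exceptional f q"
    then have a: "f (p + int q * (k + 1)) = f (p + int q)" for k by (simp add: * shift)
    \<comment> \<open>The instance \<open>-1\<close> gives \<open>f p = f (p + int q)\<close>, which
      moves the base point back.\<close>
    have "f (p + int q * k) = f p" for k using a[of "k - 1"] a[of "-1"] by simp
    then show "p \<notin> exceptional f q" by (simp add: *)
  next
    assume "p \<notin> exceptional f q"
    then have a: "f (p + int q * k) = f p" for k by (simp add: *)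
    show "p + int q \<notin> exceptional f q" unfolding * shift using a[of 1] by (simp add: a)
  qed
  then show ?thesis by blast
qed

text \<open>Any \<open>q\<close> consecutive positions meet each class once. This freedom absorbs
  the shift by \<open>m\<close> in autocorrelations and the shift by \<open>s\<close> in the
  substitution relation.\<close>

lemma exceptional_count_window:
  "exceptional_count f q = (\<Sum>r<q. of_bool (j + int r \<in> exceptional f q))"
  unfolding exceptional_count_def
  by (rule periodic_window_sum[where P = "\<lambda>p. of_bool (p \<in> exceptional f q)", symmetric])
    (simp add: exceptional_periodic)

lemma exceptional_density:
  assumes "q > 0"
  shows "sym_mean (\<lambda>j. of_bool (j \<in> exceptional f q)) \<longlonglongrightarrow> exceptional_count f q / real q"
  unfolding exceptional_count_def
  by (rule sym_mean_periodic) (use assms in \<open>auto simp: exceptional_periodic\<close>)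

text \<open>The factor \<open>2\<close> bounds \<open>f j - g j\<close> at the positions of
  \<open>E\<close>; elsewhere the terms cancel.\<close>

lemma sym_mean_near:
  fixes f g :: "int \<Rightarrow> 'b::real_normed_field"
  assumes "\<And>j. norm (f j) \<le> 1" "\<And>j. norm (g j) \<le> 1" "\<And>j. j \<notin> E \<Longrightarrow> f j = g j"
  shows "norm (sym_mean f N - sym_mean g N) \<le> 2 * sym_mean (\<lambda>j. of_bool (j \<in> E)) N"
proof -
  have "norm (f j - g j) \<le> 2 * of_bool (j \<in> E)" for j
    using norm_triangle_ineq4[of "f j" "g j"] assms(1)[of j] assms(2)[of j] assms(3)[of j] by auto
  then have "norm (\<Sum>j\<in>{- int N..int N}. f j - g j) \<le> (\<Sum>j\<in>{- int N..int N}. 2 * of_bool (j \<in> E))"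
    by (intro sum_norm_le) auto
  then have "norm (sym_mean f N - sym_mean g N)
      \<le> (\<Sum>j\<in>{- int N..int N}. 2 * of_bool (j \<in> E)) / real (2 * N + 1)"
    unfolding sym_mean_diff unfolding sym_mean_def norm_divide norm_of_nat
    by (rule divide_right_mono) simp
  also have "\<dots> = 2 * sym_mean (\<lambda>j. of_bool (j \<in> E)) N"
    unfolding sym_mean_def sum_distrib_left[symmetric] by (rule times_divide_eq_right[symmetric])
  finally show ?thesis .
qed

lemma nearly_periodic_convergent:
  fixes f :: "int \<Rightarrow> complex"
  assumes "nearly_periodic f" and le1: "\<And>j. norm (f j) \<le> 1"
  shows "convergent (sym_mean f)"
proof -
  have "Cauchy (sym_mean f)"
  proof (rule metric_CauchyI)
    fix e :: real assume "0 < e"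
    \<comment> \<open>The density \<open>e / 12\<close> stays strictly below \<open>e / 8\<close>;
      doubled by \<open>sym_mean_near\<close> it costs \<open>e / 4\<close>, and the convergence of
      the means of \<open>P\<close> costs another \<open>e / 4\<close>.\<close>
    then obtain q where q: "q > 0" "exceptional_count f q \<le> e / 12 * real q"
      using assms(1) unfolding nearly_periodic_def by (metis divide_pos_pos zero_less_numeral)
    \<comment> \<open>\<open>P\<close> repeats the values of \<open>f\<close> on
      \<open>{0..<q}\<close>. On exceptional classes this choice is arbitrary, and only the bound
      \<open>1\<close> matters there.\<close>
    define P where "P = (\<lambda>j. f (j mod int q))"
    define c where "c = (\<Sum>r<q. P (int r)) / of_nat q"
    have "sym_mean P \<longlonglongrightarrow> c"
      unfolding c_def by (rule sym_mean_periodic) (use q in \<open>auto simp: P_def\<close>)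
    then have ev1: "eventually (\<lambda>N. dist (sym_mean P N) c < e / 4) sequentially"
      using \<open>0 < e\<close> by (auto dest: tendstoD[where e = "e/4"])
    have "exceptional_count f q / real q < e / 8"
      using q \<open>0 < e\<close> by (simp add: divide_simps) (smt (verit) mult_pos_pos of_nat_0_less_iff)
    then have ev2: "eventually (\<lambda>N. sym_mean (\<lambda>j. of_bool (j \<in> exceptional f q)) N < e / 8) sequentially"
      by (rule order_tendstoD(2)[OF exceptional_density[OF q(1)]])
    have "eventually (\<lambda>N. dist (sym_mean f N) c < e / 2) sequentially"
      using ev1 ev2
    proof eventually_elim
      case (elim N)
      have "f j = P j" if "j \<notin> exceptional f q" for j
      proof -
        have "f (j + int q * (- (j div int q))) = f j" using that unfolding exceptional_def by blast
        moreover have "j + int q * (- (j div int q)) = j mod int q"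
          by (simp add: minus_mult_div_eq_mod)
        ultimately show ?thesis by (simp add: P_def)
      qed
      then have "norm (sym_mean f N - sym_mean P N) \<le> 2 * sym_mean (\<lambda>j. of_bool (j \<in> exceptional f q)) N"
        by (intro sym_mean_near) (auto simp: P_def le1)
      with elim show ?case
        using dist_triangle[of "sym_mean f N" c "sym_mean P N"] by (simp add: dist_norm)
    qed
    then obtain N0 where "\<And>N. N \<ge> N0 \<Longrightarrow> dist (sym_mean f N) c < e / 2"
      by (auto simp: eventually_sequentially)
    then show "\<exists>M. \<forall>m\<ge>M. \<forall>n\<ge>M. dist (sym_mean f m) (sym_mean f n) < e"
      by (intro exI[of _ N0]) (metis dist_triangle_half_r dist_commute)
  qed
  then show ?thesis by (rule Cauchy_convergent)
qed

text \<open>The product can vary on the class of \<open>p\<close> only if \<open>f\<close> varies on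
  the class of \<open>p\<close> or of \<open>p + m\<close>, so the exceptional count at most
  doubles.\<close>

lemma nearly_periodic_autocorr_convergent:
  fixes f :: "int \<Rightarrow> complex"
  assumes np: "nearly_periodic f" and le1: "\<And>j. norm (f j) \<le> 1"
  shows "convergent (autocorr_avg f m)"
  unfolding autocorr_avg_sym_mean
proof (rule nearly_periodic_convergent)
  let ?h = "\<lambda>j. f j * cnj (f (j + m))"
  show "norm (?h j) \<le> 1" for j by (simp add: norm_mult le1 mult_le_one)
  show "nearly_periodic ?h"
    unfolding nearly_periodic_def
  proof (intro allI impI)
    fix e :: real assume "0 < e"
    then obtain q where q: "q > 0" "exceptional_count f q \<le> e / 2 * real q"
      using np unfolding nearly_periodic_def by (metis half_gt_zero)
    have "p \<in> exceptional f q \<or> p + m \<in> exceptional f q" if "p \<in> exceptional ?h q" for p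
      using that by (auto simp: exceptional_def algebra_simps)
    then have "of_bool (int r \<in> exceptional ?h q)
        \<le> (of_bool (int r \<in> exceptional f q) + of_bool (m + int r \<in> exceptional f q) :: real)" for r
      by (cases "int r \<in> exceptional ?h q") (fastforce simp: add.commute)+
    then have "exceptional_count ?h q
        \<le> (\<Sum>r<q. of_bool (int r \<in> exceptional f q) + of_bool (m + int r \<in> exceptional f q))"
      unfolding exceptional_count_def by (intro sum_mono)
    also have "\<dots> = 2 * exceptional_count f q"
      unfolding sum.distrib exceptional_count_window[symmetric] by (simp add: exceptional_count_def)
    finally show "\<exists>q>0. exceptional_count ?h q \<le> e * real q"
      using q by auto
  qed
qed

text \<open>At a non-exceptional \<open>j\<close> the value \<open>f (j + int q * k)\<close> equals
  \<open>f j\<close>, so both autocorrelation sums have the same term there. The bound is uniform in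
  \<open>k\<close>, as the later averaging over multiples of \<open>q\<close> requires.\<close>

lemma autocorr_near_period:
  fixes f :: "int \<Rightarrow> complex"
  assumes np: "nearly_periodic f" and le1: "\<And>j. norm (f j) \<le> 1"
    and q: "q > 0" "exceptional_count f q \<le> \<epsilon> * real q"
  shows "norm (autocorr f (int q * k) - autocorr f 0) \<le> 2 * \<epsilon>"
proof -
  have lim: "autocorr_avg f m \<longlonglongrightarrow> autocorr f m" for m
    using nearly_periodic_autocorr_convergent[OF np le1] by (simp add: autocorr_def convergent_LIMSEQ_iff)
  have "norm (autocorr f (int q * k) - autocorr f 0) \<le> 2 * (exceptional_count f q / real q)"
  proof (rule tendsto_le[OF sequentially_bot])
    show "(\<lambda>N. norm (autocorr_avg f (int q * k) N - autocorr_avg f 0 N))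
        \<longlonglongrightarrow> norm (autocorr f (int q * k) - autocorr f 0)"
      by (intro tendsto_intros lim)
    show "(\<lambda>N. 2 * sym_mean (\<lambda>j. of_bool (j \<in> exceptional f q)) N) \<longlonglongrightarrow> 2 * (exceptional_count f q / real q)"
      by (intro tendsto_intros exceptional_density q)
    show "\<forall>\<^sub>F N in sequentially. norm (autocorr_avg f (int q * k) N - autocorr_avg f 0 N)
        \<le> 2 * sym_mean (\<lambda>j. of_bool (j \<in> exceptional f q)) N"
      unfolding autocorr_avg_sym_mean
      by (intro always_eventually allI sym_mean_near)
        (auto simp: norm_mult le1 mult_le_one exceptional_def)
  qed
  also have "\<dots> \<le> 2 * \<epsilon>" using q by (simp add: divide_simps)
  finally show ?thesis .
qed

section \<open>Existence of the diffraction measure\<close>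

text \<open>Orthogonality of the characters of the circle. For \<open>n \<noteq> 0\<close> the
  primitive \<open>exp (c * t) / c\<close> has equal values at both endpoints, because
  \<open>exp c = 1\<close>.\<close>

lemma integral_cis_unit_interval:
  fixes n :: int
  shows "has_bochner_integral lborel
    (\<lambda>t. indicator {0..1::real} t *\<^sub>R cis (2 * pi * of_int n * t)) (of_bool (n = 0))"
proof (cases "n = 0")
  case True
  then show ?thesis
    using has_bochner_integral_FTC_Icc[of 0 1 "\<lambda>t. complex_of_real t" "\<lambda>t. 1"]
    by (force intro!: derivative_eq_intros simp: has_vector_derivative_def scaleR_conv_of_real)
next
  case False
  define c :: complex where "c = 2 * pi * of_int n * \<i>"
  have c: "c \<noteq> 0" using False by (simp add: c_def)
  have cis: "cis (2 * pi * of_int n * t) = exp (c * of_real t)" for t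
    by (simp add: c_def cis_conv_exp mult_ac)
  have "((\<lambda>t. exp (c * of_real t) / c) has_vector_derivative exp (c * of_real t)) (at t within {0..1})" for t :: real
    by (rule has_vector_derivative_real_field) (use c in \<open>auto intro!: derivative_eq_intros\<close>)
  then have "has_bochner_integral lborel (\<lambda>t. indicator {0..1::real} t *\<^sub>R exp (c * of_real t))
      (exp (c * of_real 1) / c - exp (c * of_real 0) / c)"
    by (intro has_bochner_integral_FTC_Icc) (auto intro!: continuous_intros)
  moreover have "exp c = 1" using cis[of 1] by (metis cis_multiple_2pi Ints_of_int mult.right_neutral of_real_1)
  ultimately show ?thesis using False by (simp add: cis)
qed

section \<open>Periodograms and their Fourier coefficients\<close>

definition trig_poly :: "(int \<Rightarrow> complex) \<Rightarrow> nat \<Rightarrow> real \<Rightarrow> complex" where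
  "trig_poly f N t = (\<Sum>j\<in>{- int N..int N}. f j * cis (- 2 * pi * of_int j * t))"

text \<open>Placed on the whole real line, so that tightness and Levy's continuity theorem for
  \<open>real_distribution\<close> apply; the endpoint \<open>1\<close> is Lebesgue null.\<close>

definition periodogram :: "(int \<Rightarrow> complex) \<Rightarrow> nat \<Rightarrow> real measure" where
  "periodogram f N = density lborel
     (\<lambda>t. ennreal (indicator {0..1} t * ((cmod (trig_poly f N t))\<^sup>2 / real (2 * N + 1))))"

lemma trig_poly_measurable [measurable]: "trig_poly f N \<in> borel_measurable borel"
  unfolding trig_poly_def [abs_def]
  by (intro borel_measurable_continuous_onI continuous_intros)

lemma trig_poly_square:
  "of_real ((cmod (trig_poly f N t))\<^sup>2) * cis (- 2 * pi * of_int m * t)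
   = (\<Sum>j\<in>{- int N..int N}. \<Sum>k\<in>{- int N..int N}. f j * cnj (f k) * cis (2 * pi * of_int (k - j - m) * t))"
proof -
  have "of_real ((cmod (trig_poly f N t))\<^sup>2) * cis (- 2 * pi * of_int m * t)
      = trig_poly f N t * cnj (trig_poly f N t) * cis (- 2 * pi * of_int m * t)"
    by (simp only: complex_norm_square)
  also have "\<dots> = (\<Sum>j\<in>{- int N..int N}. \<Sum>k\<in>{- int N..int N}.
      (f j * cis (- 2 * pi * of_int j * t)) * cnj (f k * cis (- 2 * pi * of_int k * t)) * cis (- 2 * pi * of_int m * t))"
    unfolding trig_poly_def cnj_sum sum_product by (simp only: sum_distrib_right)
  also have "\<dots> = (\<Sum>j\<in>{- int N..int N}. \<Sum>k\<in>{- int N..int N}. f j * cnj (f k) * cis (2 * pi * of_int (k - j - m) * t))"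
  proof (intro sum.cong refl)
    fix j k
    have "cis (- 2 * pi * of_int j * t) * (cnj (cis (- 2 * pi * of_int k * t)) * cis (- 2 * pi * of_int m * t))
        = cis (2 * pi * of_int (k - j - m) * t)"
      by (simp add: cis_cnj cis_mult algebra_simps)
    then show "(f j * cis (- 2 * pi * of_int j * t)) * cnj (f k * cis (- 2 * pi * of_int k * t)) * cis (- 2 * pi * of_int m * t)
        = f j * cnj (f k) * cis (2 * pi * of_int (k - j - m) * t)"
      by (simp only: complex_cnj_mult mult_ac)
  qed
  finally show ?thesis .
qed

text \<open>Orthogonality keeps only the pairs with \<open>k = j + m\<close>. The result is the
  autocorrelation average truncated to pairs with both positions in the window.\<close>

lemma periodogram_bochner:
  "has_bochner_integral lborel
     (\<lambda>t. (indicator {0..1} t * ((cmod (trig_poly f N t))\<^sup>2 / real (2 * N + 1))) *\<^sub>R cis (- 2 * pi * of_int m * t))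
     ((\<Sum>j\<in>{- int N..int N}. of_bool (j + m \<in> {- int N..int N}) * (f j * cnj (f (j + m)))) / of_nat (2 * N + 1))"
proof -
  let ?I = "{- int N..int N}"
  have "has_bochner_integral lborel
      (\<lambda>t. (\<Sum>j\<in>?I. \<Sum>k\<in>?I. f j * cnj (f k) * (indicator {0..1} t *\<^sub>R cis (2 * pi * of_int (k - j - m) * t))) / of_nat (2 * N + 1))
      ((\<Sum>j\<in>?I. \<Sum>k\<in>?I. f j * cnj (f k) * of_bool (k - j - m = 0)) / of_nat (2 * N + 1))"
    by (intro has_bochner_integral_divide_zero has_bochner_integral_sum has_bochner_integral_mult_right
        integral_cis_unit_interval)
  moreover have "(\<Sum>j\<in>?I. \<Sum>k\<in>?I. f j * cnj (f k) * (indicator {0..1} t *\<^sub>R cis (2 * pi * of_int (k - j - m) * t))) / of_nat (2 * N + 1)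
      = (indicator {0..1} t * ((cmod (trig_poly f N t))\<^sup>2 / real (2 * N + 1))) *\<^sub>R cis (- 2 * pi * of_int m * t)" for t
  proof -
    have "(\<Sum>j\<in>?I. \<Sum>k\<in>?I. f j * cnj (f k) * (indicator {0..1} t *\<^sub>R cis (2 * pi * of_int (k - j - m) * t)))
        = indicator {0..1} t *\<^sub>R (of_real ((cmod (trig_poly f N t))\<^sup>2) * cis (- 2 * pi * of_int m * t))"
      unfolding trig_poly_square by (simp only: scaleR_sum_right mult_scaleR_right)
    then show ?thesis
      by (simp add: scaleR_conv_of_real del: of_nat_add)
  qed
  moreover have "(\<Sum>k\<in>?I. f j * cnj (f k) * of_bool (k - j - m = 0)) = of_bool (j + m \<in> ?I) * (f j * cnj (f (j + m)))" for j
  proof -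
    have "(\<Sum>k\<in>?I. f j * cnj (f k) * of_bool (k - j - m = 0)) = (\<Sum>k\<in>?I. if k = j + m then f j * cnj (f k) else 0)"
      by (intro sum.cong) auto
    then show ?thesis by (simp only: sum.delta finite_atLeastAtMost_int) auto
  qed
  ultimately show ?thesis by simp
qed

lemma periodogram_fourier:
  "(LINT t|periodogram f N. cis (- 2 * pi * of_int m * t))
   = (\<Sum>j\<in>{- int N..int N}. of_bool (j + m \<in> {- int N..int N}) * (f j * cnj (f (j + m)))) / of_nat (2 * N + 1)"
  unfolding periodogram_def
  using has_bochner_integral_integral_eq[OF periodogram_bochner[of f N m]]
  by (subst integral_density) (auto intro!: borel_measurable_continuous_onI continuous_intros)

text \<open>The total mass is the coefficient at \<open>0\<close>, which is the mean of the squared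
  moduli of \<open>f\<close>.\<close>

lemma periodogram_real_distribution:
  assumes "\<And>j. cmod (f j) = 1"
  shows "real_distribution (periodogram f N)"
proof -
  let ?g = "\<lambda>t. indicator {0..1::real} t * ((cmod (trig_poly f N t))\<^sup>2 / real (2 * N + 1))"
  have 1: "(\<Sum>j\<in>{- int N..int N}. of_bool (j + 0 \<in> {- int N..int N}) * (f j * cnj (f (j + 0)))) / of_nat (2 * N + 1) = 1"
  proof -
    have "(\<Sum>j\<in>{- int N..int N}. of_bool (j + 0 \<in> {- int N..int N}) * (f j * cnj (f (j + 0)))) = (\<Sum>j\<in>{- int N..int N}. 1)"
      using assms by (intro sum.cong) (auto simp flip: complex_norm_square)
    also have "\<dots> = of_nat (2 * N + 1)" by (subst sum_constant, simp)
    finally have sum: "(\<Sum>j\<in>{- int N..int N}. of_bool (j + 0 \<in> {- int N..int N}) * (f j * cnj (f (j + 0)))) = of_nat (2 * N + 1)" .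
    have "complex_of_nat (2 * N + 1) \<noteq> 0" by (subst of_nat_eq_0_iff) simp
    then show ?thesis unfolding sum by (rule divide_self)
  qed
  have "has_bochner_integral lborel (\<lambda>t. complex_of_real (?g t)) 1"
    using periodogram_bochner[of f N 0, unfolded 1] by (simp add: scaleR_conv_of_real)
  then have "has_bochner_integral lborel ?g 1"
    using has_bochner_integral_Re by fastforce
  then have "(\<integral>\<^sup>+t. ennreal (?g t) \<partial>lborel) = 1"
    by (subst nn_integral_eq_integral) (auto simp: has_bochner_integral_iff)
  then have "prob_space (periodogram f N)"
    by (intro prob_spaceI) (simp add: periodogram_def emeasure_density)
  then show ?thesis
    by (simp add: real_distribution_def real_distribution_axioms_def periodogram_def)
qed

lemma periodogram_tight:
  assumes "\<And>j. cmod (f j) = 1"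
  shows "tight (periodogram f)"
  unfolding tight_def
proof (intro conjI allI impI)
  show rd: "real_distribution (periodogram f n)" for n
    by (rule periodogram_real_distribution[OF assms])
  fix e :: real assume "0 < e"
  have "measure (periodogram f n) {-1<..2} = 1" for n
  proof -
    interpret real_distribution "periodogram f n" by (rule rd)
    have "emeasure (periodogram f n) {-1<..2} = emeasure (periodogram f n) UNIV"
      unfolding periodogram_def
      by (simp add: emeasure_density) (auto intro!: nn_integral_cong simp: indicator_def)
    then show ?thesis using emeasure_space_1 by (simp add: measure_def)
  qed
  then show "\<exists>a b. a < b \<and> (\<forall>n. measure (periodogram f n) {a<..b} > 1 - e)"
    using \<open>0 < e\<close> by (intro exI[of _ "-1"] exI[of _ 2]) simp
qed

text \<open>The truncation loses only those \<open>j\<close> for which \<open>j + m\<close> leaves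
  the window. Their number is bounded independently of \<open>N\<close>, and each term has modulus
  \<open>1\<close>.\<close>

lemma periodogram_fourier_tendsto:
  assumes unimod: "\<And>j. cmod (f j) = 1" and conv: "convergent (autocorr_avg f m)"
  shows "(\<lambda>N. LINT t|periodogram f N. cis (- 2 * pi * of_int m * t)) \<longlonglongrightarrow> autocorr f m"
proof -
  have "(\<lambda>N. (LINT t|periodogram f N. cis (- 2 * pi * of_int m * t)) - autocorr_avg f m N) \<longlonglongrightarrow> 0"
  proof (rule Lim_null_comparison[OF _ const_div_odd_tendsto_0[of "2 * \<bar>m\<bar>"]], intro always_eventually allI)
    fix N
    let ?I = "{- int N..int N}"
    have "(LINT t|periodogram f N. cis (- 2 * pi * of_int m * t)) - autocorr_avg f m N
        = (\<Sum>j\<in>?I. (of_bool (j + m \<in> ?I) - 1) * (f j * cnj (f (j + m)))) / of_nat (2 * N + 1)"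
      unfolding periodogram_fourier autocorr_avg_def diff_divide_distrib[symmetric] sum_subtractf[symmetric]
      by (simp only: left_diff_distrib mult_1)
    moreover have "cmod (\<Sum>j\<in>?I. (of_bool (j + m \<in> ?I) - 1) * (f j * cnj (f (j + m)))) \<le> 2 * \<bar>m\<bar>"
    proof -
      have "cmod (\<Sum>j\<in>?I. (of_bool (j + m \<in> ?I) - 1) * (f j * cnj (f (j + m)))) \<le> (\<Sum>j\<in>?I. of_bool (j + m \<notin> ?I))"
        by (rule sum_norm_le) (auto simp: norm_mult unimod)
      also have "\<dots> = real (card (?I \<inter> {j. j + m \<notin> ?I}))" by (simp add: of_bool_def sum.If_cases)
      \<comment> \<open>Covering both ends of the window avoids a case split on the sign of
        \<open>m\<close>; hence the constant \<open>2 * \<bar>m\<bar>\<close>.\<close>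
      also have "\<dots> \<le> real (card ({- int N..<- int N + \<bar>m\<bar>} \<union> {int N - \<bar>m\<bar> <.. int N}))"
        by (intro of_nat_mono card_mono) auto
      also have "\<dots> \<le> real (card {- int N..<- int N + \<bar>m\<bar>} + card {int N - \<bar>m\<bar> <.. int N})"
        by (intro of_nat_mono card_Un_le)
      finally show ?thesis by simp
    qed
    ultimately show "cmod ((LINT t|periodogram f N. cis (- 2 * pi * of_int m * t)) - autocorr_avg f m N)
        \<le> 2 * \<bar>m\<bar> / real (2 * N + 1)"
      by (simp only: norm_divide norm_of_nat) (intro divide_right_mono, auto)
  qed
  moreover have "autocorr_avg f m \<longlonglongrightarrow> autocorr f m"
    using conv by (simp add: autocorr_def convergent_LIMSEQ_iff)
  ultimately show ?thesis by (auto dest: tendsto_add)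
qed

text \<open>A weak limit of periodograms, as in Herglotz's theorem. The characteristic function at
  \<open>- 2 * pi * of_int m\<close> is the \<open>m\<close>-th Fourier coefficient, so Levy's
  theorem identifies the coefficients of the limit.\<close>

theorem diffraction_measure_exists:
  assumes unimod: "\<And>j. cmod (f j) = 1" and conv: "\<And>m. convergent (autocorr_avg f m)"
  shows "\<exists>M. is_diffraction_measure f M"
proof -
  have tight: "tight (periodogram f)"
    using unimod by (rule periodogram_tight)
  obtain r M where r: "strict_mono (r :: nat \<Rightarrow> nat)" and M: "real_distribution M"
    and weak: "weak_conv_m (periodogram f \<circ> r) M"
    using tight_imp_convergent_subsubsequence[OF tight strict_mono_id] by auto
  interpret real_distribution M by (rule M)
  have coeff: "(LINT t|M. cis (- 2 * pi * of_int m * t)) = autocorr f m" for m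
  proof -
    have "(\<lambda>n. char ((periodogram f \<circ> r) n) (- 2 * pi * of_int m)) \<longlonglongrightarrow> char M (- 2 * pi * of_int m)"
      by (rule levy_continuity1[OF _ M weak]) (simp add: periodogram_real_distribution unimod)
    moreover have "(\<lambda>n. char ((periodogram f \<circ> r) n) (- 2 * pi * of_int m)) \<longlonglongrightarrow> autocorr f m"
      using LIMSEQ_subseq_LIMSEQ[OF periodogram_fourier_tendsto[OF unimod conv, of m] r]
      by (simp add: char_def cis_conv_exp o_def)
    ultimately have "char M (- 2 * pi * of_int m) = autocorr f m" by (rule LIMSEQ_unique)
    then show ?thesis by (simp add: char_def cis_conv_exp)
  qed
  \<comment> \<open>The limit lives on the real line and may charge the point \<open>1\<close>.
    Pushing it forward by \<open>frac\<close> lands in \<open>[0,1)\<close> and keeps the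
    coefficients, whose integrands are 1-periodic.\<close>
  define \<nu> where "\<nu> = distr M (restrict_space borel {0..<1}) frac"
  have frac: "frac \<in> measurable M (restrict_space borel {0..<1})"
  proof (rule measurable_restrict_space2)
    show "frac \<in> borel_measurable M" by (simp add: frac_def [abs_def])
  qed (auto simp: frac_lt_1)
  have "torus_measure \<nu>"
    unfolding torus_measure_def
    using prob_space_distr[OF frac] by (simp add: \<nu>_def prob_space.finite_measure)
  moreover have "fourier_coeff \<nu> m = autocorr f m" for m
  proof -
    have "cis (- 2 * pi * of_int m * frac t) = cis (- 2 * pi * of_int m * t)" for t
    proof -
      have "- 2 * pi * of_int m * frac t = - 2 * pi * of_int m * t + 2 * pi * of_int (m * \<lfloor>t\<rfloor>)"
        by (simp add: frac_def algebra_simps)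
      then show ?thesis by (simp only: cis_mult[symmetric]) (simp add: cis_multiple_2pi)
    qed
    then have "fourier_coeff \<nu> m = (LINT t|M. cis (- 2 * pi * of_int m * t))"
      unfolding fourier_coeff_def \<nu>_def
      by (subst integral_distr[OF frac])
        (auto intro!: measurable_restrict_space1 borel_measurable_continuous_onI continuous_intros)
    then show ?thesis using coeff by simp
  qed
  ultimately show ?thesis
    unfolding is_diffraction_measure_def using conv by blast
qed

section \<open>Support of the diffraction measure\<close>

text \<open>For \<open>z \<noteq> 1\<close> the geometric sums stay below
  \<open>2 / cmod (1 - z)\<close>. Indexing by \<open>Suc K\<close> keeps the denominators
  positive.\<close>

lemma cesaro_powers:
  fixes z :: complex
  assumes "cmod z = 1"
  shows "(\<lambda>K. (\<Sum>m<Suc K. z ^ m) / of_nat (Suc K)) \<longlonglongrightarrow> of_bool (z = 1)"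
proof (cases "z = 1")
  case True
  have "(\<Sum>m<Suc K. z ^ m) / of_nat (Suc K) = 1" for K
    using True by (simp del: of_nat_Suc)
  then show ?thesis using True by simp
next
  case False
  have "(\<lambda>K. (\<Sum>m<Suc K. z ^ m) / of_nat (Suc K)) \<longlonglongrightarrow> 0"
  proof (rule Lim_null_comparison, intro always_eventually allI)
    show "(\<lambda>K. (2 / cmod (1 - z)) * inverse (real (Suc K))) \<longlonglongrightarrow> 0"
      by (intro tendsto_mult_right_zero LIMSEQ_inverse_real_of_nat)
    fix K
    have "cmod (1 - z ^ Suc K) \<le> 2"
      using norm_triangle_ineq4[of 1 "z ^ Suc K"] assms by (simp add: norm_mult norm_power)
    then have "cmod (\<Sum>m<Suc K. z ^ m) \<le> 2 / cmod (1 - z)"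
      unfolding sum_gp_strict using False by (simp add: norm_divide divide_right_mono)
    from mult_right_mono[OF this, of "inverse (real (Suc K))"]
    show "norm ((\<Sum>m<Suc K. z ^ m) / of_nat (Suc K)) \<le> (2 / cmod (1 - z)) * inverse (real (Suc K))"
      by (simp only: norm_divide norm_of_nat divide_inverse[of _ "real (Suc K)"]) simp
  qed
  with False show ?thesis by simp
qed

section \<open>Concentration on the rational points\<close>

lemma torus_measure_space: "torus_measure \<nu> \<Longrightarrow> space \<nu> = {0..<1}"
  using sets_eq_imp_space_eq[of \<nu> "restrict_space borel {0..<1}"]
  by (simp add: torus_measure_def space_restrict_space)

lemma torus_measurable:
  assumes "torus_measure \<nu>" "g \<in> borel_measurable borel"
  shows "g \<in> borel_measurable \<nu>"
proof -
  have "sets \<nu> = sets (restrict_space borel {0..<1})"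
    using assms(1) by (simp add: torus_measure_def)
  from measurable_cong_sets[OF this refl] show ?thesis
    using measurable_restrict_space1[OF assms(2)] by blast
qed

lemma torus_sets:
  assumes "torus_measure \<nu>" "B \<in> sets borel" "B \<subseteq> {0..<1}"
  shows "B \<in> sets \<nu>"
  using assms by (simp add: torus_measure_def sets_restrict_space_iff)

lemma rat_borel: "(\<rat> :: real set) \<in> sets borel"
  by (rule sets.countable) (auto intro: countable_rat)

text \<open>The coefficients at multiples of \<open>q\<close> are integrals of powers of one
  unimodular function, so \<open>cesaro_powers\<close> gives the pointwise limit of the averages;
  the constant \<open>1\<close> dominates and is integrable for a finite measure.\<close>

lemma fourier_coeff_cesaro:
  assumes "torus_measure \<nu>"
  shows "(\<lambda>K. (\<Sum>m<Suc K. fourier_coeff \<nu> (int q * int m)) / of_nat (Suc K))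
    \<longlonglongrightarrow> (LINT t|\<nu>. of_bool (cis (- 2 * pi * real q * t) = 1))"
proof -
  interpret finite_measure \<nu> using assms by (simp add: torus_measure_def)
  let ?z = "\<lambda>t. cis (- 2 * pi * real q * t)"
  have meas: "(\<lambda>t. ?z t ^ m) \<in> borel_measurable \<nu>" for m
    by (intro torus_measurable[OF assms] borel_measurable_continuous_onI continuous_intros)
  have meas_lim: "(\<lambda>t. of_bool (?z t = 1) :: complex) \<in> borel_measurable \<nu>"
  proof (rule torus_measurable[OF assms])
    have "closed {t. ?z t = 1}"
      by (intro closed_Collect_eq continuous_intros)
    then have "(indicator {t. ?z t = 1} :: real \<Rightarrow> complex) \<in> borel_measurable borel"
      by (intro borel_measurable_indicator borel_closed)
    then show "(\<lambda>t. of_bool (?z t = 1) :: complex) \<in> borel_measurable borel"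
      by (simp add: indicator_def [abs_def])
  qed
  have pow: "cis (- 2 * pi * of_int (int q * int m) * t) = ?z t ^ m" for m t
    by (simp add: Complex.DeMoivre mult_ac)
  have int: "integrable \<nu> (\<lambda>t. ?z t ^ m)" for m
    by (rule integrable_const_bound[of _ 1, OF _ meas]) (simp add: norm_power)
  have "(\<lambda>K. LINT t|\<nu>. (\<Sum>m<Suc K. ?z t ^ m) / of_nat (Suc K)) \<longlonglongrightarrow> (LINT t|\<nu>. of_bool (?z t = 1))"
  proof (rule integral_dominated_convergence[where w = "\<lambda>_. 1"])
    show "AE t in \<nu>. (\<lambda>K. (\<Sum>m<Suc K. ?z t ^ m) / of_nat (Suc K)) \<longlonglongrightarrow> of_bool (?z t = 1)"
      by (intro AE_I2 cesaro_powers) simp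
    show "AE t in \<nu>. norm ((\<Sum>m<Suc K. ?z t ^ m) / of_nat (Suc K)) \<le> 1" for K
    proof (rule AE_I2)
      fix t
      have "norm (\<Sum>m<Suc K. ?z t ^ m) \<le> (\<Sum>m<Suc K. 1)"
        by (rule sum_norm_le) (simp add: norm_power)
      then show "norm ((\<Sum>m<Suc K. ?z t ^ m) / of_nat (Suc K)) \<le> 1"
        by (simp add: norm_divide del: of_nat_Suc)
    qed
    show "(\<lambda>t. (\<Sum>m<Suc K. ?z t ^ m) / of_nat (Suc K)) \<in> borel_measurable \<nu>" for K
      by (intro borel_measurable_divide borel_measurable_sum meas borel_measurable_const)
  qed (use meas_lim in simp_all)
  moreover have "(LINT t|\<nu>. (\<Sum>m<Suc K. ?z t ^ m) / of_nat (Suc K))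
      = (\<Sum>m<Suc K. fourier_coeff \<nu> (int q * int m)) / of_nat (Suc K)" for K
    unfolding fourier_coeff_def pow
    by (subst integral_divide_zero, subst Bochner_Integration.integral_sum) (rule int refl)+
  ultimately show ?thesis by (simp only:)
qed

lemma torus_measure_rational_support:
  assumes \<nu>: "torus_measure \<nu>"
    and near: "\<And>\<epsilon>. \<epsilon> > 0 \<Longrightarrow> \<exists>q>0. \<forall>k. cmod (fourier_coeff \<nu> (int q * k) - fourier_coeff \<nu> 0) \<le> \<epsilon>"
  shows "emeasure \<nu> ({0..<1} - \<rat>) = 0"
proof -
  interpret finite_measure \<nu> using \<nu> by (simp add: torus_measure_def)
  note space = torus_measure_space[OF \<nu>]
  have ratm: "{0..<1} - \<rat> \<in> sets \<nu>"
    by (intro torus_sets[OF \<nu>] sets.Diff rat_borel) auto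
  have "measure \<nu> ({0..<1} - \<rat>) \<le> 0"
  proof (rule field_le_epsilon)
    fix e :: real assume "0 < e"
    then obtain q where "q > 0" and q: "\<And>k. cmod (fourier_coeff \<nu> (int q * k) - fourier_coeff \<nu> 0) \<le> e"
      using near by blast
    \<comment> \<open>\<open>D\<close> consists of the fractions with denominator \<open>q\<close>
      in \<open>[0,1)\<close>.\<close>
    define D where "D = {t \<in> {0..<1}. cis (- 2 * pi * real q * t) = 1}"
    have Dm: "D \<in> sets \<nu>"
    proof -
      have "{t. cis (- 2 * pi * real q * t) = 1} \<in> sets borel"
        by (intro borel_closed closed_Collect_eq continuous_intros)
      then have "{0..<1} \<inter> {t. cis (- 2 * pi * real q * t) = 1} \<in> sets \<nu>"
        by (intro torus_sets[OF \<nu>] sets.Int) auto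
      then show ?thesis by (simp add: D_def Int_def)
    qed
    have "D \<subseteq> \<rat>"
    proof
      fix t assume "t \<in> D"
      then have "cos (- 2 * pi * real q * t) = 1"
        by (auto simp: D_def complex_eq_iff)
      then obtain n :: int where "real q * t = of_int n"
        by (auto simp: cos_one_2pi_int)
      then have "t = of_int n / of_nat q"
        using \<open>q > 0\<close> by (simp add: field_simps)
      then show "t \<in> \<rat>" by simp
    qed
    have zero: "fourier_coeff \<nu> 0 = of_real (measure \<nu> (space \<nu>))"
      by (simp add: fourier_coeff_def scaleR_conv_of_real)
    have D: "(LINT t|\<nu>. of_bool (cis (- 2 * pi * real q * t) = 1)) = complex_of_real (measure \<nu> D)"
    proof -
      have "(LINT t|\<nu>. of_bool (cis (- 2 * pi * real q * t) = 1)) = (LINT t|\<nu>. complex_of_real (indicator D t))"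
        by (intro Bochner_Integration.integral_cong) (auto simp: D_def space indicator_def)
      also have "\<dots> = complex_of_real (LINT t|\<nu>. indicator D t)" by (rule integral_complex_of_real)
      finally show ?thesis using Dm by simp
    qed
    \<comment> \<open>Each averaged coefficient is within \<open>e\<close> of the total mass, hence
      so is the limit of the averages, the mass of \<open>D\<close>.\<close>
    have "cmod (measure \<nu> D - fourier_coeff \<nu> 0) \<le> e"
    proof (rule tendsto_upperbound)
      show "(\<lambda>K. cmod ((\<Sum>m<Suc K. fourier_coeff \<nu> (int q * int m)) / of_nat (Suc K) - fourier_coeff \<nu> 0))
          \<longlonglongrightarrow> cmod (measure \<nu> D - fourier_coeff \<nu> 0)"
        using fourier_coeff_cesaro[OF \<nu>, of q] unfolding D by (intro tendsto_intros)
      show "\<forall>\<^sub>F K in sequentially.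
          cmod ((\<Sum>m<Suc K. fourier_coeff \<nu> (int q * int m)) / of_nat (Suc K) - fourier_coeff \<nu> 0) \<le> e"
      proof (intro always_eventually allI)
        fix K
        have "(\<Sum>m<Suc K. fourier_coeff \<nu> (int q * int m)) / of_nat (Suc K) - fourier_coeff \<nu> 0
            = (\<Sum>m<Suc K. fourier_coeff \<nu> (int q * int m) - fourier_coeff \<nu> 0) / of_nat (Suc K)"
          by (simp only: sum_subtractf sum_constant card_lessThan diff_divide_distrib) (simp del: of_nat_Suc)
        moreover have "cmod (\<Sum>m<Suc K. fourier_coeff \<nu> (int q * int m) - fourier_coeff \<nu> 0) \<le> (\<Sum>m<Suc K. e)"
          by (rule sum_norm_le) (rule q)
        ultimately show "cmod ((\<Sum>m<Suc K. fourier_coeff \<nu> (int q * int m)) / of_nat (Suc K) - fourier_coeff \<nu> 0) \<le> e"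
          by (simp add: norm_divide pos_divide_le_eq mult.commute del: of_nat_Suc sum.lessThan_Suc)
      qed
    qed simp
    then have "measure \<nu> (space \<nu>) - measure \<nu> D \<le> e"
      unfolding zero of_real_diff[symmetric] norm_of_real by linarith
    then have "measure \<nu> ({0..<1} - D) \<le> e"
      using finite_measure_compl[OF Dm] by (simp add: space)
    moreover have "measure \<nu> ({0..<1} - \<rat>) \<le> measure \<nu> ({0..<1} - D)"
      using \<open>D \<subseteq> \<rat>\<close> Dm sets.compl_sets[OF Dm] by (intro finite_measure_mono) (auto simp: space)
    ultimately show "measure \<nu> ({0..<1} - \<rat>) \<le> 0 + e" by simp
  qed
  then show ?thesis by (simp add: emeasure_eq_measure measure_le_0_iff)
qed

text \<open>Countable additivity handles \<open>B \<inter> C\<close>; points of \<open>B\<close>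
  outside \<open>C\<close> lie in a null set and add nothing to either side.\<close>

lemma pure_point_countable_support:
  assumes "countable C" "\<And>x. {x} \<in> sets M" and null: "emeasure M (space M - C) = 0"
  shows "pure_point_measure M"
  unfolding pure_point_measure_def
proof
  fix B assume B: "B \<in> sets M"
  have "C \<in> sets M"
    by (rule sets.countable) (use assms(1,2) in auto)
  then have C: "B \<inter> C \<in> sets M" and CS: "space M - C \<in> sets M"
    using B by auto
  have sub: "N \<subseteq> space M - C \<Longrightarrow> emeasure M N = 0" for N
    using emeasure_mono[OF _ CS, of N] null by simp
  have "emeasure M B = emeasure M (B \<inter> C) + emeasure M (B - B \<inter> C)"
    using plus_emeasure[of "B \<inter> C" M "B - B \<inter> C"] B C by (simp add: Un_absorb1 Int_Diff)
  also have "emeasure M (B - B \<inter> C) = 0"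
    using sets.sets_into_space[OF B] by (intro sub) auto
  also have "emeasure M (B \<inter> C) + 0 = (\<integral>\<^sup>+x. emeasure M {x} \<partial>count_space (B \<inter> C))"
    using assms by (subst emeasure_countable_singleton) auto
  also have "\<dots> = (\<integral>\<^sup>+x. emeasure M {x} * indicator (B \<inter> C) x \<partial>count_space UNIV)"
    by (simp add: nn_integral_count_space_indicator)
  also have "\<dots> = (\<integral>\<^sup>+x. emeasure M {x} * indicator B x \<partial>count_space UNIV)"
  proof (rule nn_integral_cong)
    fix x show "emeasure M {x} * indicator (B \<inter> C) x = emeasure M {x} * indicator B x"
      using sets.sets_into_space[OF B] sub[of "{x}"] by (auto simp: indicator_def)
  qed
  also have "\<dots> = (\<integral>\<^sup>+x. emeasure M {x} \<partial>count_space B)"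
    by (simp add: nn_integral_count_space_indicator)
  finally show "emeasure M B = (\<integral>\<^sup>+x. emeasure M {x} \<partial>count_space B)" .
qed

text \<open>Integer translations preserve irrationality, so every slice of the irrationals is the
  same null set.\<close>

lemma periodisation_pure_point:
  assumes \<nu>: "torus_measure \<nu>" and null: "emeasure \<nu> ({0..<1} - \<rat>) = 0"
  shows "pure_point_measure (periodisation \<nu>)"
proof (rule pure_point_countable_support)
  show "countable (\<rat> :: real set)" by (rule countable_rat)
  show "{x} \<in> sets (periodisation \<nu>)" for x by (simp add: periodisation_def)
  have "emeasure (periodisation \<nu>) (UNIV - \<rat>)
      = (\<integral>\<^sup>+ n. emeasure \<nu> {t \<in> {0..<1}. of_int n + t \<in> UNIV - \<rat>} \<partial>count_space (UNIV :: int set))"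
    by (intro emeasure_periodisation[OF \<nu>] sets.Diff rat_borel) auto
  also have "\<dots> = (\<integral>\<^sup>+ n. emeasure \<nu> ({0..<1} - \<rat>) \<partial>count_space (UNIV :: int set))"
    by (intro nn_integral_cong arg_cong2[where f = emeasure]) (auto simp: Rats_add_iff)
  finally show "emeasure (periodisation \<nu>) (space (periodisation \<nu>) - \<rat>) = 0"
    using null by (simp add: periodisation_def)
qed

text \<open>The support argument sees a diffraction measure only through its Fourier coefficients,
  so it covers every candidate \<open>M\<close> and not just the weak limit constructed
  before.\<close>

theorem nearly_periodic_pure_point_diffraction:
  assumes np: "nearly_periodic f" and unimod: "\<And>j. cmod (f j) = 1"
  shows "pure_point_diffraction f"
  unfolding pure_point_diffraction_def
proof (intro conjI allI impI)
  have le1: "cmod (f j) \<le> 1" for j by (simp add: unimod)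
  show "\<exists>M. is_diffraction_measure f M"
    by (intro diffraction_measure_exists unimod nearly_periodic_autocorr_convergent np le1)
  fix M assume "is_diffraction_measure f M"
  then obtain \<nu> where \<nu>: "torus_measure \<nu>" "\<And>m. fourier_coeff \<nu> m = autocorr f m" "M = periodisation \<nu>"
    by (auto simp: is_diffraction_measure_def)
  have "emeasure \<nu> ({0..<1} - \<rat>) = 0"
  proof (rule torus_measure_rational_support[OF \<nu>(1)])
    fix e :: real assume "e > 0"
    \<comment> \<open>Half of \<open>e\<close> compensates the factor \<open>2\<close> in
      \<open>autocorr_near_period\<close>.\<close>
    then obtain q where "q > 0" "exceptional_count f q \<le> e / 2 * real q"
      using np unfolding nearly_periodic_def by (metis half_gt_zero)
    then show "\<exists>q>0. \<forall>k. cmod (fourier_coeff \<nu> (int q * k) - fourier_coeff \<nu> 0) \<le> e"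
      using autocorr_near_period[OF np le1, of q "e / 2"] by (auto simp: \<nu>(2))
  qed
  then show "pure_point_measure M"
    unfolding \<nu>(3) by (rule periodisation_pure_point[OF \<nu>(1)])
qed

section \<open>Substitutions with a constant column\<close>

text \<open>The position \<open>L * m + j + s\<close> can be exceptional modulo
  \<open>L ^ Suc n\<close> only if \<open>m\<close> is exceptional modulo \<open>L ^ n\<close> and
  \<open>j \<noteq> j0\<close>. Each level thus multiplies the count by at most
  \<open>L - 1\<close>, while the modulus grows by \<open>L\<close>.\<close>

lemma subst_nearly_periodic:
  fixes f :: "int \<Rightarrow> 'b"
  assumes rec: "\<And>m j. j < L \<Longrightarrow> f (int L * m + int j + s) = F j (f m)"
    and const: "j0 < L" "\<And>x y. F j0 x = F j0 y"
  shows "nearly_periodic f"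
proof -
  let ?E = "\<lambda>n. exceptional f (L ^ n)"
  have step: "exceptional_count f (L ^ Suc n) \<le> real (L - 1) * exceptional_count f (L ^ n)" for n
  proof -
    have mem: "j \<noteq> j0 \<and> m \<in> ?E n" if E: "s + int (m' * L + j) \<in> ?E (Suc n)" and "j < L" and m: "m = int m'" for m j m'
    proof -
      obtain k where k: "f (s + int (m' * L + j) + int (L ^ Suc n) * k) \<noteq> f (s + int (m' * L + j))"
        using E unfolding exceptional_def by blast
      \<comment> \<open>A translation by \<open>L ^ Suc n * k\<close> becomes a translation of the
        block index \<open>m\<close> by \<open>L ^ n * k\<close>.\<close>
      have e: "s + int (m' * L + j) + int (L ^ Suc n) * k = int L * (m + int (L ^ n) * k) + int j + s"
        "s + int (m' * L + j) = int L * m + int j + s"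
        using m by (simp_all add: algebra_simps)
      have "F j (f (m + int (L ^ n) * k)) \<noteq> F j (f m)"
        using k unfolding e(1) unfolding e(2) rec[OF \<open>j < L\<close>] .
      then have "f (m + int (L ^ n) * k) \<noteq> f m" "j \<noteq> j0"
        using const(2) by auto
      then show ?thesis unfolding exceptional_def by blast
    qed
    \<comment> \<open>Starting the window at \<open>s\<close> aligns its blocks of length
      \<open>L\<close> with the images of single letters.\<close>
    have "exceptional_count f (L ^ Suc n) = (\<Sum>r<L ^ n * L. of_bool (s + int r \<in> ?E (Suc n)))"
      by (subst exceptional_count_window[of _ _ s]) (simp add: mult.commute)
    also have "\<dots> = (\<Sum>m<L ^ n. \<Sum>r\<in>{m * L..<m * L + L}. of_bool (s + int r \<in> ?E (Suc n)))"
      by (rule sum.nat_group[symmetric])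
    also have "\<dots> = (\<Sum>m<L ^ n. \<Sum>j<L. of_bool (s + int (m * L + j) \<in> ?E (Suc n)))"
      by (simp only: sum.atLeastLessThan_shift_0[where m = "m * L" for m] add_diff_cancel_left' atLeast0LessThan o_def)
    also have "\<dots> \<le> (\<Sum>m<L ^ n. \<Sum>j<L. of_bool (j \<noteq> j0) * of_bool (int m \<in> ?E n))"
      using mem by (intro sum_mono) auto
    also have "\<dots> = (\<Sum>j<L. of_bool (j \<noteq> j0)) * exceptional_count f (L ^ n)"
      by (simp add: exceptional_count_def sum_distrib_right sum_distrib_left sum.swap[of _ _ "{..<L}"])
    also have "(\<Sum>j<L. of_bool (j \<noteq> j0)) = real (card ({..<L} - {j0}))"
    proof -
      have "{..<L} \<inter> {j. j \<noteq> j0} = {..<L} - {j0}" by auto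
      then show ?thesis by (simp add: of_bool_def sum.If_cases)
    qed
    also have "card ({..<L} - {j0}) = L - 1" using const(1) by simp
    finally show ?thesis .
  qed
  \<comment> \<open>At \<open>n = 0\<close> the modulus is \<open>1\<close>, with a single class to
    count.\<close>
  have count: "exceptional_count f (L ^ n) \<le> real (L - 1) ^ n" for n
  proof (induction n)
    case (Suc n)
    show ?case using step[of n] mult_left_mono[OF Suc, of "real (L - 1)"] by simp
  qed (simp add: exceptional_count_def)
  show ?thesis
    unfolding nearly_periodic_def
  proof (intro allI impI)
    fix e :: real assume "0 < e"
    have "real (L - 1) / real L < 1" using const(1) by (simp add: divide_simps)
    from real_arch_pow_inv[OF \<open>0 < e\<close> this] obtain n where "(real (L - 1) / real L) ^ n < e" by auto
    then have "real (L - 1) ^ n \<le> e * real (L ^ n)"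
      using const(1) by (simp add: power_divide divide_simps)
    then show "\<exists>q>0. exceptional_count f q \<le> e * real q"
      using count[of n] const(1) by (intro exI[of _ "L ^ n"]) auto
  qed
qed

text \<open>Both sides of the pseudo-fixed-point equation are read at position
  \<open>L * m + j\<close>, which is the letter with offset \<open>j\<close> in block
  \<open>m\<close>.\<close>

lemma pseudo_fixed_point_recursion:
  assumes "constant_length \<rho> L" "0 < L" "pseudo_fixed_point \<rho> L w"
  obtains s where "\<And>m j. j < L \<Longrightarrow> w (int L * m + int j + int s) = subst_column \<rho> j (w m)"
proof -
  obtain s where s: "subst_biseq \<rho> w = (shift ^^ s) w"
    using assms(3) by (auto simp: pseudo_fixed_point_def)
  have shift: "(shift ^^ s) w n = w (n + int s)" for n
    by (induction s arbitrary: n) (simp_all add: shift_def algebra_simps)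
  have "w (int L * m + int j + int s) = subst_column \<rho> j (w m)" if "j < L" for m j
    using subst_biseq_constant_length[OF assms(1,2), of w "int L * m + int j"] that
    by (simp add: s shift subst_column_def)
  then show thesis by (rule that)
qed

theorem theorem4p12:
  fixes \<rho> :: "'a::{topological_ab_group_add, t2_space} \<Rightarrow> 'a list"
    and L :: nat
    and w :: "int \<Rightarrow> 'a"
    and chi :: "'a \<Rightarrow> complex"
  assumes "compact (UNIV :: 'a set)"
    and "substitution \<rho>"
    and "constant_length \<rho> L"
    and "\<And>j. j < L \<Longrightarrow> group_translation (subst_column \<rho> j) \<or> constant_map (subst_column \<rho> j)"
    and "\<exists>j<L. constant_map (subst_column \<rho> j)"
    and "pseudo_fixed_point \<rho> L w"
    and "character chi"
  shows "pure_point_diffraction (\<lambda>m. chi (w m))"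
proof (rule nearly_periodic_pure_point_diffraction)
  show "cmod (chi (w j)) = 1" for j
    using assms(7) by (simp add: character_def)
  have hom: "chi (a + b) = chi a * chi b" for a b
    using assms(7) by (simp add: character_def)
  obtain j0 where j0: "j0 < L" "constant_map (subst_column \<rho> j0)"
    using assms(5) by blast
  then obtain s where s: "\<And>m j. j < L \<Longrightarrow> w (int L * m + int j + int s) = subst_column \<rho> j (w m)"
    using pseudo_fixed_point_recursion[OF assms(3) _ assms(6)] by auto
  \<comment> \<open>A character turns a translation by \<open>b\<close> into multiplication by
    \<open>chi b\<close>, so the recursion for \<open>w\<close> descends to its image under
    \<open>chi\<close>.\<close>
  have factor: "\<exists>F. (\<forall>a. chi (subst_column \<rho> j a) = F (chi a)) \<and>
      (constant_map (subst_column \<rho> j) \<longrightarrow> (\<forall>x y. F x = F y))" if "j < L" for j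
  \<comment> \<open>Constancy is tested first: on a trivial group a translation is also constant,
    and \<open>F\<close> must then be constant on all complex numbers, not only on the range of
    \<open>chi\<close>.\<close>
  proof (cases "constant_map (subst_column \<rho> j)")
    case True
    then obtain b where "\<And>a. subst_column \<rho> j a = b" by (auto simp: constant_map_def)
    then show ?thesis by (intro exI[of _ "\<lambda>_. chi b"]) simp
  next
    case False
    then obtain b where "\<And>a. subst_column \<rho> j a = b + a"
      using assms(4)[OF \<open>j < L\<close>] by (auto simp: group_translation_def)
    then show ?thesis using False by (intro exI[of _ "\<lambda>x. chi b * x"]) (simp add: hom)
  qed
  then have "\<forall>j\<in>{..<L}. \<exists>F. (\<forall>a. chi (subst_column \<rho> j a) = F (chi a)) \<and>
      (constant_map (subst_column \<rho> j) \<longrightarrow> (\<forall>x y. F x = F y))"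
    by simp
  from bchoice[OF this] obtain F where F: "\<And>j a. j < L \<Longrightarrow> chi (subst_column \<rho> j a) = F j (chi a)"
    "\<And>j x y. j < L \<Longrightarrow> constant_map (subst_column \<rho> j) \<Longrightarrow> F j x = F j y"
    by auto
  show "nearly_periodic (\<lambda>m. chi (w m))"
    by (rule subst_nearly_periodic[where s = "int s" and F = F and ?j0.0 = j0]) (use s F j0 in auto)
qed

end
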